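(* Let $D\ge 1$ be an integer. For each $N=1,2,3,\ldots$ let $|\psi_N\rangle\in\mathcal{P}_N$ be a nonzero permutation symmetric vector in $\mathcal{H}_N=(\mathbb{C}^{D+1})^{\otimes N}$, with associated quantum state $\psi_N$, and suppose that the sequence $(\psi_N)_{N\ge 1}$ converges as $N\to\infty$, in the local-operator topology, to a linear map $\psi$ on the finitely-supported operators. Let $\mu$ be a probability measure on $\mathbb{C}\mathrm{P}^D$ representing $\psi$, i.e. such that $$\psi(\mathcal{O})=\int_{\mathbb{C}\mathrm{P}^D} d\mu(\mathbf{v})\,\psi_{\mathbf{v}}(\mathcal{O})$$ for every finitely-supported operator $\mathcal{O}$. Then for every integer $n>1$ and every fixed integer $m\geq 1$, the R\'enyi entropy $S_n(\psi_N;m)$ of the state $\psi_N$ with respect to a subsystem of $m$ sites converges as $N\to\infty$ to $$S_n=\frac{1}{1-n}\log\left[\int_{(\mathbb{C}\mathrm{P}^D)^{\times n}}\left(\prod_{\alpha=1}^n d\mu(\mathbf{v}_\alpha)\right)\left(\prod_{\alpha=1}^n\frac{\mathbf{v}_\alpha^{\dagger}\cdot\mathbf{v}_{\alpha+1}}{\mathbf{v}_\alpha^{\dagger}\cdot\mathbf{v}_\alpha}\right)^m\right],$$ where $\mathbf{v}_{n+1}:=\mathbf{v}_1$ and $\mathbf{v}_\alpha^{\dagger}$ is the conjugate transpose of the column vector $\mathbf{v}_\alpha$.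
   Context: Setting: $D=2s$ where $s\in\{\tfrac12,1,\tfrac32,\ldots\}$ is the spin, and $\mathcal{H}_N=(\mathbb{C}^{D+1})^{\otimes N}$ is the Hilbert space of $N$ sites, with its standard Hermitian inner product. $\mathcal{P}_N\subset\mathcal{H}_N$ is the subspace of vectors invariant under all permutations of the $N$ tensor factors (sites). States: to a nonzero vector $|\psi_N\rangle\in\mathcal{P}_N$ one associates the quantum state, i.e. the linear map $\psi_N:\mathrm{End}(\mathcal{H}_N)\to\mathbb{C}$, $\psi_N(\mathcal{O})=\langle\psi_N|\mathcal{O}|\psi_N\rangle/\langle\psi_N|\psi_N\rangle$. Finitely-supported operators: a finitely-supported operator is an element $\mathcal{O}\in\mathrm{End}(\mathcal{H}_\ell)$ for some finite $\ell$. For $N\ge\ell$ it is regarded as an element of $\mathrm{End}(\mathcal{H}_N)$ acting as $\mathcal{O}$ on $\ell$ of the sites (say the first $\ell$) and as the identity on the remaining sites; by permutation symmetry, the choice of the $\ell$ sites does not affect $\psi_N(\mathcal{O})$. Local-operator topology: the sequence $(\psi_N)$ converges to $\psi$ in the local-operator topology if for every finitely-supported operator $\mathcal{O}$ the limit $\lim_{N\to\infty}\psi_N(\mathcal{O})$ exists; $\psi$ is then the linear map on finitely-supported operators given by $\psi(\mathcal{O})=\lim_{N\to\infty}\psi_N(\mathcal{O})$. Zero-entanglement states: points of $\mathbb{C}\mathrm{P}^D$ are represented by homogeneous coordinates, i.e. nonzero column vectors $\mathbf{v}\in\mathbb{C}^{D+1}$ up to nonzero complex scalars. For $\mathbf{v}\in\mathbb{C}\mathrm{P}^D$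 and a finitely-supported $\mathcal{O}\in\mathrm{End}(\mathcal{H}_\ell)$, set $\psi_{\mathbf{v}}(\mathcal{O})=\dfrac{(\mathbf{v}^{\dagger})^{\otimes\ell}\,\mathcal{O}\,\mathbf{v}^{\otimes\ell}}{(\mathbf{v}^{\dagger}\cdot\mathbf{v})^{\ell}}$. This depends only on the point of $\mathbb{C}\mathrm{P}^D$. Measures: measures on $\mathbb{C}\mathrm{P}^D$ are Borel measures. The integrand in the formula for $S_n$ is a well-defined function on $(\mathbb{C}\mathrm{P}^D)^{\times n}$. R\'enyi entropy: for $N\ge m$, let $A$ be a set of $m$ sites and $\bar A$ its complement, so that $\mathcal{H}_N=\mathcal{H}_A\otimes\mathcal{H}_{\bar A}$. Put $\rho_A=\mathrm{Tr}_{\mathcal{H}_{\bar A}}\big(|\psi_N\rangle\langle\psi_N|\big)/\langle\psi_N|\psi_N\rangle$ and $S_n(\psi_N;m)=\dfrac{1}{1-n}\log\mathrm{Tr}_{\mathcal{H}_A}(\rho_A^n)$. By permutation symmetry this depends only on $m=|A|$. *)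

theory Defs
  imports "HOL-Probability.Probability"
begin

section \<open>Tensor powers of \<open>\<complex>\<^sup>d\<close> over a finite set of sites\<close>

text \<open>
  The one-site space is \<open>complex ^ 'd\<close>, with its coordinate basis indexed by \<open>'d\<close>. For a finite
  set \<open>I\<close> of sites, the tensor product of the one-site spaces over \<open>I\<close> has the orthonormal product
  basis indexed by the configurations \<open>x : I \<rightarrow> 'd\<close>. Vectors and operators are given by
  their coefficients in this basis and vanish outside it. The chain of \<open>N\<close> sites is
  \<open>I = {..<N}\<close>.
\<close>

type_synonym 'd config = "nat \<Rightarrow> 'd"
type_synonym 'd vect = "'d config \<Rightarrow> complex"
type_synonym 'd oper = "'d config \<Rightarrow> 'd config \<Rightarrow> complex"

definition configs :: "nat set \<Rightarrow> 'd config set" where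
  "configs I = I \<rightarrow>\<^sub>E UNIV"

definition hilb :: "nat set \<Rightarrow> 'd vect set" where
  "hilb I = {\<phi>. \<forall>x. x \<notin> configs I \<longrightarrow> \<phi> x = 0}"

definition End_hilb :: "nat set \<Rightarrow> 'd oper set" where
  "End_hilb I = {T. \<forall>x y. x \<notin> configs I \<or> y \<notin> configs I \<longrightarrow> T x y = 0}"

definition braket :: "nat set \<Rightarrow> 'd vect \<Rightarrow> 'd vect \<Rightarrow> complex" where
  "braket I \<phi> \<eta> = (\<Sum>x\<in>configs I. cnj (\<phi> x) * \<eta> x)"

definition op_app :: "nat set \<Rightarrow> 'd oper \<Rightarrow> 'd vect \<Rightarrow> 'd vect" where
  "op_app I T \<phi> = (\<lambda>x. \<Sum>y\<in>configs I. T x y * \<phi> y)"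

definition op_id :: "nat set \<Rightarrow> 'd oper" where
  "op_id I = (\<lambda>x y. if x \<in> configs I \<and> x = y then 1 else 0)"

definition op_mult :: "nat set \<Rightarrow> 'd oper \<Rightarrow> 'd oper \<Rightarrow> 'd oper" where
  "op_mult I T P = (\<lambda>x y. \<Sum>z\<in>configs I. T x z * P z y)"

primrec op_pow :: "nat set \<Rightarrow> 'd oper \<Rightarrow> nat \<Rightarrow> 'd oper" where
  "op_pow I T 0 = op_id I"
| "op_pow I T (Suc n) = op_mult I T (op_pow I T n)"

definition op_trace :: "nat set \<Rightarrow> 'd oper \<Rightarrow> complex" where
  "op_trace I T = (\<Sum>x\<in>configs I. T x x)"

definition ketbra :: "'d vect \<Rightarrow> 'd oper" where
  "ketbra \<phi> = (\<lambda>x y. \<phi> x * cnj (\<phi> y))"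

text \<open>
  \<open>partial_trace A B\<close> traces out \<open>B\<close> from an operator on the sites \<open>A \<union> B\<close>, with \<open>A\<close> and \<open>B\<close>
  disjoint; \<open>merge A B (x, z)\<close> is the configuration that is \<open>x\<close> on \<open>A\<close> and \<open>z\<close> on \<open>B\<close>.
\<close>

definition partial_trace :: "nat set \<Rightarrow> nat set \<Rightarrow> 'd oper \<Rightarrow> 'd oper" where
  "partial_trace A B T = (\<lambda>x y.
     if x \<in> configs A \<and> y \<in> configs A
     then \<Sum>z\<in>configs B. T (merge A B (x, z)) (merge A B (y, z)) else 0)"


section \<open>Permutation-symmetric vectors and their quantum states\<close>

text \<open>The site permutation \<open>\<pi>\<close> acts on a vector \<open>\<phi>\<close> by \<open>x \<mapsto> \<phi> (x \<circ> \<pi>)\<close>.\<close>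

definition sym_hilb :: "nat \<Rightarrow> 'd vect set" where
  "sym_hilb N = {\<phi> \<in> hilb {..<N}. \<forall>\<pi>. \<pi> permutes {..<N} \<longrightarrow> (\<forall>x\<in>configs {..<N}. \<phi> (x \<circ> \<pi>) = \<phi> x)}"

definition qstate :: "nat \<Rightarrow> 'd vect \<Rightarrow> 'd oper \<Rightarrow> complex" where
  "qstate N \<phi> T = braket {..<N} \<phi> (op_app {..<N} T \<phi>) / braket {..<N} \<phi> \<phi>"

text \<open>
  A finitely-supported operator is a pair of a number \<open>l\<close> and some \<open>T \<in> End_hilb {..<l}\<close>. For
  \<open>l \<le> N\<close>, \<open>extend_op l N T\<close> acts as \<open>T\<close> on the first \<open>l\<close> of \<open>N\<close> sites and as the identity on the
  others.
\<close>

definition extend_op :: "nat \<Rightarrow> nat \<Rightarrow> 'd oper \<Rightarrow> 'd oper" where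
  "extend_op l N T = (\<lambda>x y.
     if x \<in> configs {..<N} \<and> y \<in> configs {..<N} \<and> (\<forall>i\<in>{l..<N}. x i = y i)
     then T (restrict x {..<l}) (restrict y {..<l}) else 0)"

definition local_op_limit ::
  "(nat \<Rightarrow> 'd vect) \<Rightarrow> (nat \<Rightarrow> 'd oper \<Rightarrow> complex) \<Rightarrow> bool" where
  "local_op_limit \<Psi> \<psi> \<longleftrightarrow>
     (\<forall>l. \<forall>T\<in>End_hilb {..<l}. (\<lambda>N. qstate N (\<Psi> N) (extend_op l N T)) \<longlonglongrightarrow> \<psi> l T)"


section \<open>Complex projective space\<close>

quotient_type 'd cproj = "complex ^ 'd" /
  partial: "\<lambda>v w :: complex ^ 'd. v \<noteq> 0 \<and> w \<noteq> 0 \<and> (\<exists>c. c \<noteq> 0 \<and> w = c *s v)"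
proof (rule part_equivpI)
  show "\<exists>v :: complex ^ 'd. v \<noteq> 0 \<and> v \<noteq> 0 \<and> (\<exists>c. c \<noteq> 0 \<and> v = c *s v)"
    by (intro exI[of _ "1 :: complex ^ 'd"] conjI exI[of _ "1 :: complex"]) auto
  show "symp (\<lambda>v w :: complex ^ 'd. v \<noteq> 0 \<and> w \<noteq> 0 \<and> (\<exists>c. c \<noteq> 0 \<and> w = c *s v))"
  proof (rule sympI, elim conjE exE, intro conjI)
    fix v w :: "complex ^ 'd" and c :: complex
    assume "c \<noteq> 0" "w = c *s v"
    then show "\<exists>c. c \<noteq> 0 \<and> v = c *s w"
      by (intro exI[of _ "inverse c"]) (simp add: vector_smult_assoc)
  qed
  show "transp (\<lambda>v w :: complex ^ 'd. v \<noteq> 0 \<and> w \<noteq> 0 \<and> (\<exists>c. c \<noteq> 0 \<and> w = c *s v))"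
  proof (rule transpI, elim conjE exE, intro conjI)
    fix u v w :: "complex ^ 'd" and b c :: complex
    assume "b \<noteq> 0" "v = b *s u" "c \<noteq> 0" "w = c *s v"
    then show "\<exists>c. c \<noteq> 0 \<and> w = c *s u"
      by (intro exI[of _ "c * b"]) (simp add: vector_smult_assoc)
  qed
qed

text \<open>
  Quotient topology from the nonzero vectors (an open set, so openness in \<open>complex ^ 'd\<close> and in the
  subspace agree). The \<open>borel\<close> \<open>\<sigma>\<close>-algebra on \<open>'d cproj\<close> refers to this topology.
\<close>

instantiation cproj :: (finite) topological_space
begin

definition open_cproj :: "'a cproj set \<Rightarrow> bool" where
  "open_cproj U \<longleftrightarrow> open {v :: complex ^ 'a. v \<noteq> 0 \<and> abs_cproj v \<in> U}"

instance
proof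
  have "{v :: complex ^ 'a. v \<noteq> 0 \<and> abs_cproj v \<in> UNIV} = - {0}"
    by auto
  then show "open (UNIV :: 'a cproj set)"
    unfolding open_cproj_def by (metis open_Compl closed_singleton)
next
  fix S T :: "'a cproj set"
  assume "open S" "open T"
  moreover have "{v :: complex ^ 'a. v \<noteq> 0 \<and> abs_cproj v \<in> S \<inter> T} =
      {v. v \<noteq> 0 \<and> abs_cproj v \<in> S} \<inter> {v. v \<noteq> 0 \<and> abs_cproj v \<in> T}"
    by auto
  ultimately show "open (S \<inter> T)"
    by (simp only: open_cproj_def open_Int)
next
  fix K :: "'a cproj set set"
  assume "\<forall>S\<in>K. open S"
  moreover have "{v :: complex ^ 'a. v \<noteq> 0 \<and> abs_cproj v \<in> \<Union>K} =
      (\<Union>S\<in>K. {v. v \<noteq> 0 \<and> abs_cproj v \<in> S})"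
    by auto
  ultimately show "open (\<Union>K)"
    by (simp only: open_cproj_def open_UN)
qed

end


section \<open>Zero-entanglement states and the cyclic overlap\<close>

definition herm :: "complex ^ 'd \<Rightarrow> complex ^ 'd \<Rightarrow> complex" where
  "herm v w = (\<Sum>i\<in>UNIV. cnj (v $ i) * w $ i)"

definition tensor_power :: "nat \<Rightarrow> complex ^ 'd \<Rightarrow> 'd vect" where
  "tensor_power l v = (\<lambda>x. if x \<in> configs {..<l} then \<Prod>i<l. v $ x i else 0)"

lemma herm_smult: "herm (a *s v) (b *s w) = cnj a * b * herm v w"
  by (simp add: herm_def sum_distrib_left algebra_simps)

lemma herm_self_nonzero: "v \<noteq> 0 \<Longrightarrow> herm v v \<noteq> 0"
proof
  assume "herm v v = 0"
  moreover have "herm v v = complex_of_real (\<Sum>i\<in>UNIV. (cmod (v $ i))\<^sup>2)"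
    unfolding herm_def of_real_sum
    by (intro sum.cong refl) (metis complex_norm_square mult.commute)
  ultimately have "(\<Sum>i\<in>UNIV. (cmod (v $ i))\<^sup>2) = 0"
    by (simp only: of_real_eq_0_iff)
  then have "v = 0"
    by (simp add: sum_nonneg_eq_0_iff vec_eq_iff)
  moreover assume "v \<noteq> 0"
  ultimately show False by simp
qed

lemma tensor_power_smult: "tensor_power l (c *s v) x = c ^ l * tensor_power l v x"
  by (simp add: tensor_power_def prod.distrib)

lift_definition zero_ent_state :: "'d::finite cproj \<Rightarrow> nat \<Rightarrow> 'd oper \<Rightarrow> complex" is
  "\<lambda>v l T. braket {..<l} (tensor_power l v) (op_app {..<l} T (tensor_power l v)) / herm v v ^ l"
proof (elim conjE exE, intro ext)
  fix v w :: "complex ^ 'd" and c :: complex and l :: nat and T :: "'d oper"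
  assume c: "c \<noteq> 0" "w = c *s v"
  have "op_app {..<l} T (tensor_power l w) x = c ^ l * op_app {..<l} T (tensor_power l v) x" for x
    by (simp add: c(2) op_app_def tensor_power_smult sum_distrib_left algebra_simps)
  then have "braket {..<l} (tensor_power l w) (op_app {..<l} T (tensor_power l w)) =
      (cnj c * c) ^ l * braket {..<l} (tensor_power l v) (op_app {..<l} T (tensor_power l v))"
    by (simp add: c(2) braket_def tensor_power_smult sum_distrib_left power_mult_distrib
        algebra_simps)
  moreover have "herm w w ^ l = (cnj c * c) ^ l * herm v v ^ l"
    by (simp add: c(2) herm_smult power_mult_distrib)
  ultimately show "braket {..<l} (tensor_power l v) (op_app {..<l} T (tensor_power l v))
      / herm v v ^ l =
      braket {..<l} (tensor_power l w) (op_app {..<l} T (tensor_power l w)) / herm w w ^ l"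
    using c(1) by simp
qed

text \<open>
  The cyclic product over \<open>\<alpha>\<close> of \<open>v\<^sub>\<alpha>\<^sup>\<dagger>v\<^sub>\<alpha>\<^sub>+\<^sub>1 / v\<^sub>\<alpha>\<^sup>\<dagger>v\<^sub>\<alpha>\<close>,
  with \<open>\<alpha>\<close> running over \<open>0, \<dots>, n - 1\<close> and \<open>v\<^sub>n = v\<^sub>0\<close>. The definition uses
  arbitrarily chosen homogeneous coordinates; the lemma following it shows that the choice is
  immaterial.
\<close>

definition cyclic_overlap :: "nat \<Rightarrow> (nat \<Rightarrow> 'd::finite cproj) \<Rightarrow> complex" where
  "cyclic_overlap n p =
     (\<Prod>\<alpha><n. herm (rep_cproj (p \<alpha>)) (rep_cproj (p (Suc \<alpha> mod n)))
            / herm (rep_cproj (p \<alpha>)) (rep_cproj (p \<alpha>)))"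

lemma rep_abs_cproj:
  assumes "v \<noteq> 0"
  obtains c where "c \<noteq> 0" "rep_cproj (abs_cproj v) = c *s v"
proof -
  have "\<exists>c. c \<noteq> 0 \<and> v = c *s rep_cproj (abs_cproj v)"
    using Quotient3_rep_abs[OF Quotient3_cproj, of v] assms
    by (metis vector_smult_lid zero_neq_one)
  then obtain c where "c \<noteq> 0" "v = c *s rep_cproj (abs_cproj v)"
    by blast
  then have "rep_cproj (abs_cproj v) = inverse c *s v"
    by (metis left_inverse vector_smult_assoc vector_smult_lid)
  with \<open>c \<noteq> 0\<close> that[of "inverse c"] show ?thesis
    by simp
qed

lemma prod_cyclic_shift:
  fixes f :: "nat \<Rightarrow> complex"
  shows "(\<Prod>\<alpha><n. f (Suc \<alpha> mod n)) = (\<Prod>\<alpha><n. f \<alpha>)"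
proof (cases n)
  case (Suc k)
  have "(\<Prod>\<alpha><n. f (Suc \<alpha> mod n)) = (\<Prod>\<alpha><k. f (Suc \<alpha>)) * f 0"
    by (simp add: Suc)
  also have "\<dots> = (\<Prod>\<alpha><n. f \<alpha>)"
    by (simp only: Suc prod.lessThan_Suc_shift mult.commute)
  finally show ?thesis .
qed simp

lemma cyclic_overlap_abs:
  assumes "\<And>\<alpha>. \<alpha> < n \<Longrightarrow> v \<alpha> \<noteq> 0" and "\<And>\<alpha>. \<alpha> < n \<Longrightarrow> p \<alpha> = abs_cproj (v \<alpha>)"
  shows "cyclic_overlap n p = (\<Prod>\<alpha><n. herm (v \<alpha>) (v (Suc \<alpha> mod n)) / herm (v \<alpha>) (v \<alpha>))"
proof -
  have "\<exists>b. \<alpha> < n \<longrightarrow> b \<noteq> 0 \<and> rep_cproj (p \<alpha>) = b *s v \<alpha>" for \<alpha>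
  proof (cases "\<alpha> < n")
    case True
    with assms show ?thesis
      using rep_abs_cproj[of "v \<alpha>"] by metis
  qed simp
  then have "\<exists>c. \<forall>\<alpha><n. c \<alpha> \<noteq> 0 \<and> rep_cproj (p \<alpha>) = c \<alpha> *s v \<alpha>"
    by (intro choice allI)
  then obtain c where "\<forall>\<alpha><n. c \<alpha> \<noteq> 0 \<and> rep_cproj (p \<alpha>) = c \<alpha> *s v \<alpha>" ..
  then have c: "c \<alpha> \<noteq> 0" "rep_cproj (p \<alpha>) = c \<alpha> *s v \<alpha>" if "\<alpha> < n" for \<alpha>
    using that by simp_all
  have "cyclic_overlap n p =
      (\<Prod>\<alpha><n. c (Suc \<alpha> mod n) / c \<alpha> * (herm (v \<alpha>) (v (Suc \<alpha> mod n)) / herm (v \<alpha>) (v \<alpha>)))"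
    unfolding cyclic_overlap_def
  proof (rule prod.cong[OF refl])
    fix \<alpha> assume "\<alpha> \<in> {..<n}"
    then have "\<alpha> < n" "Suc \<alpha> mod n < n" by simp_all
    from c[OF this(1)] c[OF this(2)] show "herm (rep_cproj (p \<alpha>)) (rep_cproj (p (Suc \<alpha> mod n)))
        / herm (rep_cproj (p \<alpha>)) (rep_cproj (p \<alpha>)) =
        c (Suc \<alpha> mod n) / c \<alpha> * (herm (v \<alpha>) (v (Suc \<alpha> mod n)) / herm (v \<alpha>) (v \<alpha>))"
      by (simp add: herm_smult)
  qed
  also have "(\<Prod>\<alpha><n. c (Suc \<alpha> mod n) / c \<alpha>) = 1"
    by (simp add: prod_dividef prod_cyclic_shift c)
  then have "(\<Prod>\<alpha><n. c (Suc \<alpha> mod n) / c \<alpha> * (herm (v \<alpha>) (v (Suc \<alpha> mod n)) / herm (v \<alpha>) (v \<alpha>))) =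
      (\<Prod>\<alpha><n. herm (v \<alpha>) (v (Suc \<alpha> mod n)) / herm (v \<alpha>) (v \<alpha>))"
    by (simp only: prod.distrib mult_1_left)
  finally show ?thesis .
qed


section \<open>R\'enyi entropy\<close>

definition reduced_density :: "nat \<Rightarrow> nat set \<Rightarrow> 'd vect \<Rightarrow> 'd oper" where
  "reduced_density N A \<phi> = (\<lambda>x y.
     partial_trace A ({..<N} - A) (ketbra \<phi>) x y / braket {..<N} \<phi> \<phi>)"

text \<open>
  The trace of \<open>\<rho>\<^sub>A\<^sup>n\<close> is real (see \<open>renyi_trace_real\<close> below), so taking its real part only
  changes the type.
\<close>

definition renyi_entropy :: "nat \<Rightarrow> nat \<Rightarrow> 'd vect \<Rightarrow> nat set \<Rightarrow> real" where
  "renyi_entropy n N \<phi> A =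
     1 / (1 - real n) * ln (Re (op_trace A (op_pow A (reduced_density N A \<phi>) n)))"

lemma reduced_density_hermitian:
  "cnj (reduced_density N A \<phi> x y) = reduced_density N A \<phi> y x"
  by (simp add: reduced_density_def partial_trace_def ketbra_def braket_def mult.commute)

lemma op_mult_assoc: "op_mult I (op_mult I T P) Q = op_mult I T (op_mult I P Q)"
  unfolding op_mult_def sum_distrib_left sum_distrib_right
  by (intro ext, subst sum.swap) (simp add: mult.assoc)

lemma op_pow_commute:
  assumes "x \<in> configs I" "y \<in> configs I" and fin: "finite (configs I :: 'd config set)"
  shows "op_mult I (op_pow I T n) T x y = op_mult I T (op_pow I T n) x (y :: 'd config)"
  using assms(1,2)
proof (induction n arbitrary: x)
  case 0
  then show ?case
    using fin by (simp add: op_mult_def op_id_def if_distrib[of "\<lambda>a. a * _"]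
        if_distrib[of "\<lambda>a. _ * a"] sum.delta' sum.delta cong: if_cong)
next
  case (Suc n)
  have "op_mult I (op_pow I T (Suc n)) T x y = op_mult I T (op_mult I (op_pow I T n) T) x y"
    by (simp add: op_mult_assoc)
  also have "\<dots> = (\<Sum>z\<in>configs I. T x z * op_mult I (op_pow I T n) T z y)"
    by (simp add: op_mult_def)
  also have "\<dots> = (\<Sum>z\<in>configs I. T x z * op_mult I T (op_pow I T n) z y)"
    using Suc by (intro sum.cong) auto
  finally show ?case
    by (simp add: op_mult_def)
qed

lemma op_pow_hermitian:
  assumes "x \<in> configs I" "y \<in> configs I" and fin: "finite (configs I :: 'd config set)"
    and herm: "\<And>x y. cnj (T x y) = T y x"
  shows "cnj (op_pow I T n x y) = op_pow I T n y (x :: 'd config)"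
  using assms(1,2)
proof (induction n arbitrary: x y)
  case 0
  then show ?case
    by (simp add: op_id_def)
next
  case (Suc n)
  have "cnj (op_pow I T (Suc n) x y) = op_mult I (op_pow I T n) T y x"
    using Suc by (simp add: op_mult_def herm mult.commute)
  also have "\<dots> = op_mult I T (op_pow I T n) y x"
    using Suc.prems fin by (intro op_pow_commute)
  finally show ?case
    by simp
qed

lemma renyi_trace_real: "op_trace A (op_pow A (reduced_density N A \<phi>) n) \<in> \<real>"
proof (cases "finite (configs A :: 'a config set)")
  case True
  then show ?thesis
    by (simp add: Reals_cnj_iff op_trace_def op_pow_hermitian reduced_density_hermitian)
qed (simp add: op_trace_def)

end

theory Submission
  imports Defs
begin

text \<open>
  The entries of the reduced density matrix \<open>\<rho>\<^sub>N\<close> on the first \<open>m\<close> sites are expectations of matrix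
  units, so they converge to \<open>\<integral> V\<^sub>p(x) cnj (V\<^sub>p(y)) d\<mu>(p)\<close>, where \<open>V\<^sub>p\<close> is the normalised \<open>m\<close>-th
  tensor power of \<open>p\<close>. Expanding \<open>Tr \<rho>\<^sup>n\<close> as a sum over closed paths of configurations and
  exchanging the finite sum with the product of integrals gives the integral over \<open>n\<close> copies of
  projective space; for fixed points the sum over paths factorises into the cyclic overlap to the
  power \<open>m\<close>. To take logarithms one needs the limit to be positive: writing \<open>\<rho> = M M\<^sup>\<dagger>\<close> with
  \<open>Tr \<rho> = 1\<close>, Cauchy--Schwarz gives \<open>(Tr \<rho>\<^sup>k)\<^sup>2 \<le> d Tr \<rho>\<^sup>2\<^sup>k\<close> for matrices of size \<open>d\<close> and
  \<open>(Tr \<rho>\<^sup>k\<^sup>+\<^sup>1)\<^sup>2 \<le> Tr \<rho>\<^sup>2\<^sup>k\<^sup>+\<^sup>1\<close>, hence lower bounds that do not depend on \<open>N\<close>.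
\<close>


subsection \<open>Traces of powers\<close>

lemma finite_configs: "finite I \<Longrightarrow> finite (configs I :: 'd::finite config set)"
  by (simp add: configs_def finite_PiE)

lemma op_id_mult:
  assumes "finite (configs I :: 'd config set)" and "x \<in> configs I"
  shows "op_mult I (op_id I) T x (y :: 'd config) = T x y"
  using assms by (simp add: op_mult_def op_id_def if_distrib[of "\<lambda>a. a * _"] sum.delta cong: if_cong)

lemma op_pow_add:
  assumes fin: "finite (configs I :: 'd config set)" and "x \<in> configs I"
  shows "op_pow I T (a + b) x y = op_mult I (op_pow I T a) (op_pow I T b) x (y :: 'd config)"
  using assms(2)
proof (induction a arbitrary: x)
  case 0
  then show ?case
    using fin by (simp add: op_id_mult)
next
  case (Suc a)
  have "op_pow I T (Suc a + b) x y = (\<Sum>z\<in>configs I. T x z * op_pow I T (a + b) z y)"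
    by (simp add: op_mult_def)
  also have "\<dots> = op_mult I T (op_mult I (op_pow I T a) (op_pow I T b)) x y"
    unfolding op_mult_def[of I T] using Suc.IH by (intro sum.cong) auto
  finally show ?case
    by (simp add: op_mult_assoc)
qed

text \<open>The induction appends a vertex at the end of the path, so \<open>op_pow_commute\<close>
  first moves the new factor to the right. The start \<open>x\<close> is imposed by the
  \<open>if\<close> rather than built into the index set: the paths then form the same set for every
  \<open>x\<close>, and a later sum over \<open>x\<close> can be carried out inside.\<close>

lemma op_pow_paths:
  assumes fin: "finite (configs I :: 'd config set)" and "x \<in> configs I" "y \<in> configs I"
  shows "op_pow I T (Suc k) x (y :: 'd config) =
    (\<Sum>w\<in>{..<Suc k} \<rightarrow>\<^sub>E configs I.
       if w 0 = x then (\<Prod>\<alpha><k. T (w \<alpha>) (w (Suc \<alpha>))) * T (w k) y else 0)"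
  using assms(3)
proof (induction k arbitrary: y)
  case 0
  have inj: "inj_on (\<lambda>z. (\<lambda>i\<in>{0::nat}. z)) (configs I :: 'd config set)"
    by (rule inj_onI) (metis restrict_apply singletonI)
  have "{..<Suc 0} \<rightarrow>\<^sub>E configs I = (\<lambda>z. (\<lambda>i\<in>{0::nat}. z)) ` (configs I :: 'd config set)"
    by (auto simp: lessThan_Suc PiE_def Pi_def extensional_def image_iff fun_eq_iff restrict_def)
  then have "(\<Sum>w\<in>{..<Suc 0} \<rightarrow>\<^sub>E configs I.
      if w 0 = x then (\<Prod>\<alpha><0. T (w \<alpha>) (w (Suc \<alpha>))) * T (w 0) y else 0) =
      (\<Sum>z\<in>configs I. if z = x then T z y else 0)"
    using inj by (simp add: sum.reindex cong: if_cong)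
  also have "\<dots> = T x y"
    using fin assms(2) by (simp add: sum.delta)
  \<comment> \<open>\<open>op_pow_commute\<close> at exponent 0 replaces \<open>T\<close> times
    identity by identity times \<open>T\<close>, which \<open>op_id_mult\<close> simplifies.\<close>
  finally show ?case
    using op_pow_commute[OF assms(2) 0 fin, of T 0] fin assms(2) by (simp add: op_id_mult)
next
  case (Suc k)
  let ?W = "{..<Suc k} \<rightarrow>\<^sub>E (configs I :: 'd config set)"
  have "op_pow I T (Suc (Suc k)) x y = op_mult I (op_pow I T (Suc k)) T x y"
    using op_pow_commute[OF assms(2) Suc.prems fin, of T "Suc k"] by simp
  also have "\<dots> = (\<Sum>z\<in>configs I. \<Sum>w\<in>?W.
      (if w 0 = x then (\<Prod>\<alpha><k. T (w \<alpha>) (w (Suc \<alpha>))) * T (w k) z else 0) * T z y)"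
    unfolding op_mult_def by (intro sum.cong refl) (simp only: Suc.IH sum_distrib_right)
  also have "\<dots> = (\<Sum>(z, w)\<in>configs I \<times> ?W.
      (if w 0 = x then (\<Prod>\<alpha><k. T (w \<alpha>) (w (Suc \<alpha>))) * T (w k) z else 0) * T z y)"
    by (simp add: sum.cartesian_product)
  \<comment> \<open>An old path and a vertex \<open>z\<close> combine to the path with
    \<open>z\<close> at index \<open>Suc k\<close>. This index lies outside the old domain, so the
    combination is injective.\<close>
  also have "\<dots> = (\<Sum>w\<in>(\<lambda>(z, w). w(Suc k := z)) ` (configs I \<times> ?W).
      if w 0 = x then (\<Prod>\<alpha><Suc k. T (w \<alpha>) (w (Suc \<alpha>))) * T (w (Suc k)) y else 0)"
  proof (subst sum.reindex[OF inj_combinator], simp, rule sum.cong[OF refl], clarify)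
    fix z and w :: "nat \<Rightarrow> 'd config"
    have "(\<Prod>\<alpha><k. T ((w(Suc k := z)) \<alpha>) ((w(Suc k := z)) (Suc \<alpha>))) = (\<Prod>\<alpha><k. T (w \<alpha>) (w (Suc \<alpha>)))"
      by (intro prod.cong) auto
    then show "(if w 0 = x then (\<Prod>\<alpha><k. T (w \<alpha>) (w (Suc \<alpha>))) * T (w k) z else 0) * T z y =
      ((\<lambda>w. if w 0 = x then (\<Prod>\<alpha><Suc k. T (w \<alpha>) (w (Suc \<alpha>))) * T (w (Suc k)) y else 0) \<circ>
        (\<lambda>(z, w). w(Suc k := z))) (z, w)"
      by simp
  qed
  also have "(\<lambda>(z, w). w(Suc k := z)) ` (configs I \<times> ?W) = {..<Suc (Suc k)} \<rightarrow>\<^sub>E configs I"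
    by (simp only: lessThan_Suc[of "Suc k"] PiE_insert_eq)
  finally show ?case .
qed

text \<open>Summing over \<open>x\<close> under the constraint \<open>w 0 = x\<close> closes the
  path, and \<open>Suc \<alpha> mod n\<close> returns to 0 at the last vertex. For
  \<open>n = 0\<close> the right side would be 1 and the left side the dimension.\<close>

lemma op_trace_pow_eq:
  assumes fin: "finite (configs I :: 'd config set)" and "n \<ge> 1"
  shows "op_trace I (op_pow I T n) =
    (\<Sum>w\<in>{..<n} \<rightarrow>\<^sub>E (configs I :: 'd config set). \<Prod>\<alpha><n. T (w \<alpha>) (w (Suc \<alpha> mod n)))"
proof -
  obtain k where n: "n = Suc k"
    using assms(2) by (cases n) auto
  have "op_trace I (op_pow I T n) = (\<Sum>w\<in>{..<Suc k} \<rightarrow>\<^sub>E configs I. \<Sum>x\<in>configs I.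
      if w 0 = x then (\<Prod>\<alpha><k. T (w \<alpha>) (w (Suc \<alpha>))) * T (w k) x else 0)"
    unfolding op_trace_def n using fin by (subst sum.swap) (simp only: op_pow_paths cong: sum.cong)
  also have "\<dots> = (\<Sum>w\<in>{..<n} \<rightarrow>\<^sub>E configs I. \<Prod>\<alpha><n. T (w \<alpha>) (w (Suc \<alpha> mod n)))"
  proof (unfold n, rule sum.cong[OF refl])
    fix w assume "w \<in> {..<Suc k} \<rightarrow>\<^sub>E (configs I :: 'd config set)"
    then have "w 0 \<in> configs I"
      by auto
    moreover have "(\<Prod>\<alpha><k. T (w \<alpha>) (w (Suc \<alpha> mod Suc k))) = (\<Prod>\<alpha><k. T (w \<alpha>) (w (Suc \<alpha>)))"
      by (intro prod.cong) auto
    ultimately show "(\<Sum>x\<in>configs I. if w 0 = x then (\<Prod>\<alpha><k. T (w \<alpha>) (w (Suc \<alpha>))) * T (w k) x else 0)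
        = (\<Prod>\<alpha><Suc k. T (w \<alpha>) (w (Suc \<alpha> mod Suc k)))"
      using fin by (simp add: sum.delta')
  qed
  finally show ?thesis .
qed

text \<open>Used in two ways: to move from an arbitrary set of sites to the first ones and, with
  \<open>e = id\<close>, to exchange operators that are only known to agree on
  configurations.\<close>

lemma op_trace_pow_reindex:
  assumes e: "bij_betw e (configs I) (configs J)"
    and T: "\<And>x y. x \<in> configs I \<Longrightarrow> y \<in> configs I \<Longrightarrow> P (e x) (e y) = T x y"
  shows "op_trace J (op_pow J P n) = op_trace I (op_pow I T n)"
proof -
  have "op_pow J P n (e x) (e y) = op_pow I T n x y" if "x \<in> configs I" "y \<in> configs I" for x y
    using that
  proof (induction n arbitrary: x)
    case 0
    then show ?case
      using e by (auto simp: op_id_def bij_betw_def inj_on_eq_iff)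
  next
    case (Suc n)
    have "op_pow J P (Suc n) (e x) (e y) = (\<Sum>z\<in>configs I. P (e x) (e z) * op_pow J P n (e z) (e y))"
      by (simp add: op_mult_def sum.reindex_bij_betw[OF e, symmetric])
    with Suc T show ?case
      by (simp add: op_mult_def)
  qed
  then show ?thesis
    by (simp add: op_trace_def sum.reindex_bij_betw[OF e, symmetric])
qed


subsection \<open>Lower bounds for the traces of powers of a density matrix\<close>

lemma cmod_sum_mult_squared_le:
  fixes a b :: "'a \<Rightarrow> complex"
  shows "(cmod (\<Sum>i\<in>S. a i * b i))\<^sup>2 \<le> (\<Sum>i\<in>S. (cmod (a i))\<^sup>2) * (\<Sum>i\<in>S. (cmod (b i))\<^sup>2)"
proof -
  have "cmod (\<Sum>i\<in>S. a i * b i) \<le> (\<Sum>i\<in>S. cmod (a i) * cmod (b i))"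
    by (rule order_trans[OF norm_sum]) (simp add: norm_mult)
  then have "(cmod (\<Sum>i\<in>S. a i * b i))\<^sup>2 \<le> (\<Sum>i\<in>S. cmod (a i) * cmod (b i))\<^sup>2"
    by (intro power_mono) auto
  also have "\<dots> \<le> (\<Sum>i\<in>S. (cmod (a i))\<^sup>2) * (\<Sum>i\<in>S. (cmod (b i))\<^sup>2)"
    by (rule Cauchy_Schwarz_ineq_sum)
  finally show ?thesis .
qed

definition gram :: "'b set \<Rightarrow> ('d config \<Rightarrow> 'b \<Rightarrow> complex) \<Rightarrow> 'd oper" where
  "gram J M = (\<lambda>x y. \<Sum>z\<in>J. M x z * cnj (M y z))"

lemma gram_hermitian: "cnj (gram J M x y) = gram J M y x"
  by (simp add: gram_def mult.commute)

text \<open>As \<open>P = T^k\<close> is Hermitian, \<open>T^(2k)\<close> is \<open>P\<close> times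
  its adjoint, and its trace is the sum of the squared moduli of all entries of \<open>P\<close>.
  The diagonal entries contribute at most that much, and Cauchy--Schwarz against the all-ones vector
  bounds their sum.\<close>

lemma trace_pow_even_ge:
  fixes T :: "'d config \<Rightarrow> 'd config \<Rightarrow> complex"
  assumes fin: "finite (configs I :: 'd config set)" and herm: "\<And>x y. cnj (T x y) = T y x"
  shows "(cmod (op_trace I (op_pow I T k)))\<^sup>2
    \<le> card (configs I :: 'd config set) * Re (op_trace I (op_pow I T (k + k)))"
proof -
  let ?S = "configs I :: 'd config set" and ?P = "op_pow I T k"
  have "op_trace I (op_pow I T (k + k)) = (\<Sum>x\<in>?S. \<Sum>z\<in>?S. ?P x z * cnj (?P x z))"
    unfolding op_trace_def using fin herm
    by (intro sum.cong refl) (simp add: op_pow_add, simp add: op_mult_def op_pow_hermitian)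
  also have "\<dots> = complex_of_real (\<Sum>x\<in>?S. \<Sum>z\<in>?S. (cmod (?P x z))\<^sup>2)"
    by (simp only: of_real_sum complex_norm_square)
  finally have tr: "Re (op_trace I (op_pow I T (k + k))) = (\<Sum>x\<in>?S. \<Sum>z\<in>?S. (cmod (?P x z))\<^sup>2)"
    by (simp only: Re_complex_of_real)
  have "(cmod (op_trace I ?P))\<^sup>2 \<le> (\<Sum>x\<in>?S. (cmod (?P x x))\<^sup>2) * (\<Sum>x\<in>?S. (cmod 1)\<^sup>2)"
    using cmod_sum_mult_squared_le[of "\<lambda>x. ?P x x" "\<lambda>x. 1" ?S] by (simp add: op_trace_def)
  also have "\<dots> \<le> (\<Sum>x\<in>?S. \<Sum>z\<in>?S. (cmod (?P x z))\<^sup>2) * card ?S"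
    using fin member_le_sum[of _ ?S "\<lambda>z. (cmod (?P _ z))\<^sup>2"]
    by (simp add: mult_right_mono sum_mono)
  finally show ?thesis
    by (simp add: tr mult.commute)
qed

text \<open>For \<open>T = M M^dagger\<close> and \<open>B = T^k M\<close>,
  \<open>Tr T^(k+1)\<close> is the Hilbert--Schmidt pairing of \<open>B\<close> with
  \<open>M\<close>, and \<open>Tr T^(2k+1)\<close> is the squared norm of \<open>B\<close>. Since
  \<open>M\<close> has norm 1, Cauchy--Schwarz concludes; no square root of \<open>T\<close>
  occurs.\<close>

lemma trace_pow_odd_ge:
  fixes M :: "'d config \<Rightarrow> 'b \<Rightarrow> complex"
  assumes fin: "finite (configs I :: 'd config set)"
    and unit: "(\<Sum>x\<in>configs I. \<Sum>z\<in>J. (cmod (M x z))\<^sup>2) = 1"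
  shows "(cmod (op_trace I (op_pow I (gram J M) (Suc k))))\<^sup>2
    \<le> Re (op_trace I (op_pow I (gram J M) (Suc (k + k))))"
proof -
  let ?S = "configs I :: 'd config set" and ?T = "gram J M" and ?P = "op_pow I (gram J M) k"
  define B where "B x z = (\<Sum>y\<in>?S. ?P x y * M y z)" for x z
  have PT: "op_mult I ?P ?T x w = (\<Sum>z\<in>J. B x z * cnj (M w z))" for x w
    unfolding op_mult_def gram_def B_def sum_distrib_left sum_distrib_right
    by (subst sum.swap) (simp add: mult.assoc)
  have "op_trace I (op_pow I ?T (Suc k)) = (\<Sum>x\<in>?S. op_mult I ?P ?T x x)"
    unfolding op_trace_def using fin by (intro sum.cong refl) (simp add: op_pow_commute)
  then have tr1: "op_trace I (op_pow I ?T (Suc k)) = (\<Sum>(x, z)\<in>?S \<times> J. B x z * cnj (M x z))"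
    by (simp only: PT sum.cartesian_product)
  have "op_trace I (op_pow I ?T (Suc (k + k))) = (\<Sum>x\<in>?S. op_mult I ?P (op_pow I ?T (Suc k)) x x)"
    unfolding op_trace_def using fin op_pow_add[OF fin, of _ ?T k "Suc k"]
    by (intro sum.cong refl) simp
  \<comment> \<open>Regrouping \<open>T^(2k+1)\<close> as \<open>P T P\<close> lets the middle
    factor split into \<open>M\<close> and its adjoint.\<close>
  also have "\<dots> = (\<Sum>x\<in>?S. op_mult I (op_mult I ?P ?T) ?P x x)"
    by (simp add: op_mult_assoc)
  also have "\<dots> = (\<Sum>x\<in>?S. \<Sum>z\<in>J. B x z * cnj (B x z))"
  proof (rule sum.cong[OF refl])
    fix x assume x: "x \<in> ?S"
    have "op_mult I (op_mult I ?P ?T) ?P x x =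
        (\<Sum>w\<in>?S. \<Sum>z\<in>J. B x z * cnj (M w z) * cnj (?P x w))"
      unfolding op_mult_def[of I "op_mult I ?P ?T"] PT using x fin
      by (intro sum.cong refl) (simp add: op_pow_hermitian gram_hermitian sum_distrib_right)
    also have "\<dots> = (\<Sum>z\<in>J. B x z * cnj (B x z))"
      by (subst sum.swap) (simp add: B_def[of x] sum_distrib_left mult_ac)
    finally show "op_mult I (op_mult I ?P ?T) ?P x x = (\<Sum>z\<in>J. B x z * cnj (B x z))" .
  qed
  also have "\<dots> = complex_of_real (\<Sum>x\<in>?S. \<Sum>z\<in>J. (cmod (B x z))\<^sup>2)"
    by (simp only: of_real_sum complex_norm_square)
  finally have tr2: "Re (op_trace I (op_pow I ?T (Suc (k + k)))) =
      (\<Sum>(x, z)\<in>?S \<times> J. (cmod (B x z))\<^sup>2)"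
    by (simp only: Re_complex_of_real sum.cartesian_product)
  have "(\<Sum>p\<in>?S \<times> J. (cmod (cnj (M (fst p) (snd p))))\<^sup>2) = 1"
    using unit by (simp only: sum.cartesian_product complex_mod_cnj split_def)
  then show ?thesis
    using cmod_sum_mult_squared_le[of "\<lambda>p. B (fst p) (snd p)" "\<lambda>p. cnj (M (fst p) (snd p))" "?S \<times> J"]
    unfolding tr1 tr2 split_def by (simp only: mult_1_right)
qed

text \<open>Strong induction that roughly halves the exponent: \<open>2k\<close> reduces to
  \<open>k\<close> and \<open>2k+1\<close> to \<open>k+1\<close>, down to exponent 1, where the
  trace is 1. The constant precedes \<open>J\<close> and \<open>M\<close>, which matters because the
  environment that indexes the columns grows with \<open>N\<close>.\<close>

lemma trace_pow_uniform_lower_bound: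
  assumes fin: "finite (configs I :: 'd config set)" and "n \<ge> 1"
  shows "\<exists>c>0. \<forall>J (M :: 'd config \<Rightarrow> 'b \<Rightarrow> complex).
    (\<Sum>x\<in>configs I. \<Sum>z\<in>J. (cmod (M x z))\<^sup>2) = 1 \<longrightarrow> c \<le> Re (op_trace I (op_pow I (gram J M) n))"
  using assms(2)
proof (induction n rule: less_induct)
  case (less n)
  let ?d = "card (configs I :: 'd config set)"
  let ?unit = "\<lambda>J (M :: 'd config \<Rightarrow> 'b \<Rightarrow> complex). (\<Sum>x\<in>configs I. \<Sum>z\<in>J. (cmod (M x z))\<^sup>2) = 1"
  consider "n = 1" | k where "n = k + k" "k < n" "k \<ge> 1" | k where "n = Suc (k + k)" "Suc k < n"
  proof (cases "even n")
    case True
    then obtain k where "n = k + k"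
      by (auto elim: evenE simp: mult_2)
    with less.prems that(2)[of k] show ?thesis
      by simp
  next
    case False
    then obtain k where "n = Suc (k + k)"
      by (auto elim: oddE simp: mult_2)
    with that(1) that(3)[of k] show ?thesis
      by (cases "k = 0") simp_all
  qed
  then show ?case
  proof cases
    case 1
    have "op_trace I (op_pow I (gram J M) 1) = (\<Sum>x\<in>configs I. gram J M x x)"
      for J and M :: "'d config \<Rightarrow> 'b \<Rightarrow> complex"
      unfolding op_trace_def One_nat_def op_pow.simps(2)
      using fin op_pow_commute[OF _ _ fin, of _ _ "gram J M" 0]
      by (intro sum.cong refl) (simp add: op_id_mult)
    moreover have "gram J M x x = complex_of_real (\<Sum>z\<in>J. (cmod (M x z))\<^sup>2)"
      for J and M :: "'d config \<Rightarrow> 'b \<Rightarrow> complex" and x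
      by (simp only: gram_def of_real_sum complex_norm_square)
    ultimately have "Re (op_trace I (op_pow I (gram J M) n)) = (\<Sum>x\<in>configs I. \<Sum>z\<in>J. (cmod (M x z))\<^sup>2)"

      for J and M :: "'d config \<Rightarrow> 'b \<Rightarrow> complex"
      using 1 by simp
    then show ?thesis
      by (intro exI[of _ 1]) simp
  next
    case (2 k)
    obtain c where c: "c > 0"
        "\<And>J M. ?unit J M \<Longrightarrow> c \<le> Re (op_trace I (op_pow I (gram J M) k))"
      using less.IH[OF 2(2,3)] by (elim exE conjE) metis
    \<comment> \<open>The denominator \<open>?d + 1\<close> keeps the constant positive without a
      proof that \<open>?d\<close> is nonzero.\<close>
    have "c\<^sup>2 / (?d + 1) \<le> Re (op_trace I (op_pow I (gram J M) n))" if u: "?unit J M" for J M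
    proof -
      let ?t = "Re (op_trace I (op_pow I (gram J M) n))"
      have "c\<^sup>2 \<le> (cmod (op_trace I (op_pow I (gram J M) k)))\<^sup>2"
        using c(1) order_trans[OF c(2)[OF u] complex_Re_le_cmod] by (intro power_mono) auto
      also have "\<dots> \<le> ?d * ?t"
        unfolding 2(1) using fin by (intro trace_pow_even_ge gram_hermitian)
      finally have le: "c\<^sup>2 \<le> ?d * ?t" .
      with c(1) have "0 < real ?d * ?t"
        by (meson less_le_trans zero_less_power)
      then have "?t > 0"
        by (simp add: zero_less_mult_iff)
      with le show ?thesis
        by (simp add: divide_le_eq algebra_simps)
    qed
    with c(1) show ?thesis
      by (intro exI[of _ "c\<^sup>2 / (?d + 1)"]) auto
  next
    case (3 k)
    obtain c where c: "c > 0"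
        "\<And>J M. ?unit J M \<Longrightarrow> c \<le> Re (op_trace I (op_pow I (gram J M) (Suc k)))"
      using less.IH[OF 3(2)] by auto
    have "c\<^sup>2 \<le> Re (op_trace I (op_pow I (gram J M) n))" if u: "?unit J M" for J M
    proof -
      have "c\<^sup>2 \<le> (cmod (op_trace I (op_pow I (gram J M) (Suc k))))\<^sup>2"
        using c(1) order_trans[OF c(2)[OF u] complex_Re_le_cmod] by (intro power_mono) auto
      also have "\<dots> \<le> Re (op_trace I (op_pow I (gram J M) n))"
        unfolding 3(1) using fin u by (rule trace_pow_odd_ge)
      finally show ?thesis .
    qed
    with c(1) show ?thesis
      by (intro exI[of _ "c\<^sup>2"]) auto
  qed
qed


subsection \<open>Reduced density matrices\<close>

lemma sum_configs_merge:
  fixes f :: "'d config \<Rightarrow> 'a::comm_monoid_add"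
  assumes "A \<inter> B = {}"
  shows "(\<Sum>x\<in>configs (A \<union> B). f x) = (\<Sum>x\<in>configs A. \<Sum>z\<in>configs B. f (merge A B (x, z)))"
  unfolding sum.cartesian_product
proof (rule sum.reindex_bij_witness[of _ "merge A B" "\<lambda>x. (restrict x A, restrict x B)"])
  fix x :: "'d config" assume "x \<in> configs (A \<union> B)"
  then show "merge A B (restrict x A, restrict x B) = x"
    using assms by (auto simp: merge_def fun_eq_iff configs_def PiE_def extensional_def)
  then show "(case (restrict x A, restrict x B) of (x, z) \<Rightarrow> f (merge A B (x, z))) = f x"
    by simp
  show "(restrict x A, restrict x B) \<in> configs A \<times> configs B"
    by (auto simp: configs_def)
next
  fix p :: "'d config \<times> 'd config" assume p: "p \<in> configs A \<times> configs B"
  then have "restrict (fst p) A = fst p" "restrict (snd p) B = snd p"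
    by (auto simp: configs_def PiE_restrict)
  with assms show "(restrict (merge A B p) A, restrict (merge A B p) B) = p"
    by (cases p) simp
  show "merge A B p \<in> configs (A \<union> B)"
    by (cases p) (simp add: configs_def PiE_def)
qed

lemma braket_self: "braket I \<phi> \<phi> = complex_of_real (\<Sum>x\<in>configs I. (cmod (\<phi> x))\<^sup>2)"
  unfolding braket_def of_real_sum complex_norm_square by (simp add: mult.commute)

lemma braket_self_pos:
  fixes \<phi> :: "'d::finite vect"
  assumes "\<phi> \<in> hilb I" and "\<phi> \<noteq> (\<lambda>x. 0)" and "finite I"
  shows "(\<Sum>x\<in>configs I. (cmod (\<phi> x))\<^sup>2) > 0"
proof -
  obtain x where "\<phi> x \<noteq> 0"
    using assms(2) by auto
  with assms show ?thesis
    by (intro sum_pos2[of _ x]) (auto simp: hilb_def finite_configs)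
qed

text \<open>Normalisation makes \<open>reduced_density\<close> a Gram matrix of trace 1, so the
  uniform bound applies with one constant for all chain lengths.\<close>

lemma reduced_density_trace_pow_ge:
  assumes "finite A" and "n \<ge> 1"
  shows "\<exists>c>0. \<forall>N (\<phi> :: 'd::finite vect).
    A \<subseteq> {..<N} \<longrightarrow> \<phi> \<in> hilb {..<N} \<longrightarrow> \<phi> \<noteq> (\<lambda>x. 0) \<longrightarrow>
    c \<le> Re (op_trace A (op_pow A (reduced_density N A \<phi>) n))"
proof -
  have fin: "finite (configs A :: 'd config set)"
    using assms(1) by (rule finite_configs)
  obtain c where "c > 0" and
    c: "\<And>J (M :: 'd config \<Rightarrow> 'd config \<Rightarrow> complex). (\<Sum>x\<in>configs A. \<Sum>z\<in>J. (cmod (M x z))\<^sup>2) = 1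
      \<Longrightarrow> c \<le> Re (op_trace A (op_pow A (gram J M) n))"
    using trace_pow_uniform_lower_bound[OF fin assms(2)] by auto
  have "c \<le> Re (op_trace A (op_pow A (reduced_density N A \<phi>) n))"
    if A: "A \<subseteq> {..<N}" and \<phi>: "\<phi> \<in> hilb {..<N}" "\<phi> \<noteq> (\<lambda>x. 0)" for N and \<phi> :: "'d vect"
  proof -
    define B where "B = {..<N} - A"
    define s where "s = (\<Sum>x\<in>configs {..<N}. (cmod (\<phi> x))\<^sup>2)"
    \<comment> \<open>The vector \<open>\<phi>\<close> reshaped into a matrix from the environment
      \<open>B\<close> to \<open>A\<close>; the square root appears because \<open>gram\<close> uses
      \<open>M\<close> twice.\<close>
    define M where "M x z = \<phi> (merge A B (x, z)) / complex_of_real (sqrt s)" for x z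
    have "s > 0"
      unfolding s_def using \<phi> by (rule braket_self_pos) simp
    have AB: "{..<N} = A \<union> B" "A \<inter> B = {}"
      using A by (auto simp: B_def)
    have "(\<Sum>x\<in>configs A. \<Sum>z\<in>configs B. (cmod (M x z))\<^sup>2) = s / s"
      using \<open>s > 0\<close> sum_configs_merge[OF AB(2), of "\<lambda>x. (cmod (\<phi> x))\<^sup>2"]
      by (simp add: M_def norm_divide power_divide sum_divide_distrib[symmetric] s_def AB(1)[symmetric])
    then have "c \<le> Re (op_trace A (op_pow A (gram (configs B) M) n))"
      using \<open>s > 0\<close> by (intro c) simp
    also have "op_trace A (op_pow A (gram (configs B) M) n) =
        op_trace A (op_pow A (reduced_density N A \<phi>) n)"
    proof (rule op_trace_pow_reindex[of id])
      fix x y :: "'d config" assume "x \<in> configs A" "y \<in> configs A"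
      moreover have "complex_of_real (sqrt s) * complex_of_real (sqrt s) = complex_of_real s"
        using \<open>s > 0\<close> by (simp flip: of_real_mult)
      ultimately show "gram (configs B) M (id x) (id y) = reduced_density N A \<phi> x y"
        by (simp add: gram_def M_def reduced_density_def partial_trace_def ketbra_def braket_self
            s_def[symmetric] B_def[symmetric] sum_divide_distrib)
    qed simp
    finally show ?thesis .
  qed
  with \<open>c > 0\<close> show ?thesis
    by blast
qed

lemma bij_betw_configs:
  assumes h: "bij_betw h J I"
  shows "bij_betw (\<lambda>x. restrict (x \<circ> h) J) (configs I) (configs J)"
proof (rule bij_betw_byWitness[where f' = "\<lambda>y. restrict (y \<circ> inv_into J h) I"])
  show "\<forall>x\<in>configs I. restrict (restrict (x \<circ> h) J \<circ> inv_into J h) I = x"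
  proof
    fix x assume "x \<in> configs I"
    then have "x i = undefined" if "i \<notin> I" for i
      using that by (auto simp: configs_def)
    moreover have "h (inv_into J h i) = i" "inv_into J h i \<in> J" if "i \<in> I" for i
      using h that by (auto simp: bij_betw_inv_into_right bij_betw_def inv_into_into)
    ultimately show "restrict (restrict (x \<circ> h) J \<circ> inv_into J h) I = x"
      by (auto simp: restrict_def)
  qed
  show "\<forall>y\<in>configs J. restrict (restrict (y \<circ> inv_into J h) I \<circ> h) J = y"
  proof
    fix y assume "y \<in> configs J"
    then have "y i = undefined" if "i \<notin> J" for i
      using that by (auto simp: configs_def)
    moreover have "inv_into J h (h i) = i" "h i \<in> I" if "i \<in> J" for i
      using h that by (auto simp: bij_betw_inv_into_left bij_betw_def)
    ultimately show "restrict (restrict (y \<circ> inv_into J h) I \<circ> h) J = y"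
      by (auto simp: restrict_def)
  qed
qed (auto simp: configs_def)

text \<open>A bijection from \<open>A\<close> onto \<open>C\<close> and one between the complements
  glue to a site permutation, under which \<open>\<phi>\<close> is invariant. Tracing out the
  complement then only relabels the sum over environment configurations.\<close>

lemma reduced_density_permute:
  assumes \<phi>: "\<phi> \<in> sym_hilb N" and A: "A \<subseteq> {..<N}" "C \<subseteq> {..<N}" "card A = card C"
  obtains e where "bij_betw e (configs C) (configs A)"
    and "\<And>x y. x \<in> configs C \<Longrightarrow> y \<in> configs C \<Longrightarrow>
      reduced_density N A \<phi> (e x) (e y) = reduced_density N C \<phi> x y"
proof -
  define B where "B = {..<N} - A"
  define E where "E = {..<N} - C"
  have fin: "finite A" "finite C" "finite B" "finite E"
    using A by (auto simp: B_def E_def intro: finite_subset[OF _ finite_lessThan])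
  have "card B = card E"
    unfolding B_def E_def using A fin by (simp add: card_Diff_subset)
  obtain f where f: "bij_betw f A C"
    using finite_same_card_bij[OF fin(1,2) A(3)] by blast
  obtain g where g: "bij_betw g B E"
    using finite_same_card_bij[OF fin(3,4) \<open>card B = card E\<close>] by blast
  define \<pi> where "\<pi> i = (if i \<in> A then f i else if i \<in> B then g i else i)" for i
  have un: "A \<union> B = {..<N}" "C \<union> E = {..<N}" and disj: "A \<inter> B = {}" "C \<inter> E = {}"
    using A by (auto simp: B_def E_def)
  have "bij_betw \<pi> A C"
    using f by (subst bij_betw_cong[where g = f]) (auto simp: \<pi>_def)
  moreover have "bij_betw \<pi> B E"
    using g disj by (subst bij_betw_cong[where g = g]) (auto simp: \<pi>_def)
  ultimately have "bij_betw \<pi> (A \<union> B) (C \<union> E)"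
    using disj by (intro bij_betw_combine)
  then have \<pi>: "\<pi> permutes {..<N}"
    unfolding un using un by (intro bij_imp_permutes) (auto simp: \<pi>_def)
  define e where "e x = restrict (x \<circ> f) A" for x :: "'a config"
  define e' where "e' x = restrict (x \<circ> g) B" for x :: "'a config"
  have e: "bij_betw e (configs C) (configs A)" and e': "bij_betw e' (configs E) (configs B)"
    unfolding e_def[abs_def] e'_def[abs_def] using f g by (simp_all add: bij_betw_configs)
  have "\<phi> (merge A B (e x, e' z)) = \<phi> (merge C E (x, z))" if "x \<in> configs C" "z \<in> configs E" for x z
  proof -
    have fC: "f i \<in> C" if "i \<in> A" for i
      using f that by (auto simp: bij_betw_def)
    have gE: "g i \<in> E" "g i \<notin> C" if "i \<in> B" for i
      using g that disj by (auto simp: bij_betw_def)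
    have "merge A B (e x, e' z) = merge C E (x, z) \<circ> \<pi>"
    proof
      fix i
      \<comment> \<open>In the last case \<open>i\<close> lies off the chain: \<open>\<pi>\<close>
        fixes it and both configurations are \<open>undefined\<close> there.\<close>
      consider "i \<in> A" | "i \<in> B" "i \<notin> A" | "i \<notin> A" "i \<notin> B" "i \<notin> C" "i \<notin> E"
        using un by blast
      then show "merge A B (e x, e' z) i = (merge C E (x, z) \<circ> \<pi>) i"
        by cases (auto simp: merge_def e_def e'_def \<pi>_def fC gE)
    qed
    moreover have "merge C E (x, z) \<in> configs {..<N}"
      unfolding un(2)[symmetric] by (simp add: configs_def PiE_def)
    ultimately show ?thesis
      using \<phi> \<pi> by (simp add: sym_hilb_def)
  qed
  then have "reduced_density N A \<phi> (e x) (e y) = reduced_density N C \<phi> x y"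
    if "x \<in> configs C" "y \<in> configs C" for x y
    using that bij_betwE[OF e]
    by (simp add: reduced_density_def partial_trace_def ketbra_def B_def[symmetric] E_def[symmetric]
        sum.reindex_bij_betw[OF e', symmetric])
  with e that show ?thesis
    by blast
qed

section \<open>Entries of the reduced density matrix as local expectations\<close>

definition matrix_unit :: "'d config \<Rightarrow> 'd config \<Rightarrow> 'd oper" where
  "matrix_unit x y = (\<lambda>a b. if a = x \<and> b = y then 1 else 0)"

lemma matrix_unit_End_hilb:
  "x \<in> configs I \<Longrightarrow> y \<in> configs I \<Longrightarrow> matrix_unit x y \<in> End_hilb I"
  by (auto simp: matrix_unit_def End_hilb_def)

lemma braket_matrix_unit:
  assumes "finite (configs I :: 'd config set)" "x \<in> configs I" "y \<in> configs I"
  shows "braket I \<phi> (op_app I (matrix_unit y x) \<phi>) = \<phi> x * cnj (\<phi> (y :: 'd config))"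
proof -
  have "op_app I (matrix_unit y x) \<phi> a = (\<Sum>b\<in>configs I. if b = x then (if a = y then \<phi> x else 0) else 0)" for a
    unfolding op_app_def matrix_unit_def by (intro sum.cong) auto
  then have "op_app I (matrix_unit y x) \<phi> a = (if a = y then \<phi> x else 0)" for a
    using assms by (simp add: sum.delta)
  then have "braket I \<phi> (op_app I (matrix_unit y x) \<phi>) =
      (\<Sum>a\<in>configs I. if a = y then cnj (\<phi> y) * \<phi> x else 0)"
    unfolding braket_def by (intro sum.cong) auto
  then show ?thesis
    using assms by (simp add: sum.delta mult.commute)
qed

text \<open>The link between local-operator convergence and the entropy. The indices are swapped
  because the entry of \<open>\<rho>\<close> at \<open>x\<close>, \<open>y\<close> is the trace of
  \<open>\<rho>\<close> against \<open>|y><x|\<close>.\<close>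

lemma qstate_extend_matrix_unit:
  fixes \<phi> :: "'d::finite vect"
  assumes "l \<le> N" and x: "x \<in> configs {..<l}" and y: "y \<in> configs {..<l}"
  shows "qstate N \<phi> (extend_op l N (matrix_unit y x)) = reduced_density N {..<l} \<phi> x y"
proof -
  define L where "L = {..<l}"
  define B where "B = {l..<N}"
  have LB: "{..<N} = L \<union> B" "{..<N} - L = B" "L \<inter> B = {}"
    using assms(1) by (auto simp: L_def B_def)
  have fin: "finite (configs L :: 'd config set)" "finite (configs B :: 'd config set)"
    by (auto simp: L_def B_def intro: finite_configs)
  have ext: "extend_op l N (matrix_unit y x) (merge L B (a, z)) (merge L B (b, w)) =
      (if w = z then if b = x then if a = y then 1 else 0 else 0 else 0)"
    if "a \<in> configs L" "z \<in> configs B" "b \<in> configs L" "w \<in> configs B" for a b z w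
  proof -
    have "merge L B (a, z) \<in> configs {..<N}" "merge L B (b, w) \<in> configs {..<N}"
      unfolding LB(1) by (simp_all add: configs_def PiE_def)
    moreover have "(\<forall>i\<in>{l..<N}. merge L B (a, z) i = merge L B (b, w) i) \<longleftrightarrow> w = z"
      using that(2,4) LB(3) unfolding B_def[symmetric] configs_def
      by (auto intro!: PiE_ext[of w B _ z])
    moreover have "restrict (merge L B (a, z)) {..<l} = a" "restrict (merge L B (b, w)) {..<l} = b"
      using that LB(3) by (simp_all add: L_def[symmetric] configs_def)
    ultimately show ?thesis
      by (cases "w = z") (auto simp: extend_op_def matrix_unit_def)
  qed
  have app: "op_app {..<N} (extend_op l N (matrix_unit y x)) \<phi> (merge L B (a, z)) =
      (if a = y then \<phi> (merge L B (x, z)) else 0)" if "a \<in> configs L" "z \<in> configs B" for a z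
  proof -
    have "op_app {..<N} (extend_op l N (matrix_unit y x)) \<phi> (merge L B (a, z)) =
      (\<Sum>b\<in>configs L. \<Sum>w\<in>configs B.
        if w = z then if b = x then if a = y then \<phi> (merge L B (x, z)) else 0 else 0 else 0)"
      unfolding op_app_def LB(1) sum_configs_merge[OF LB(3)]
      using that by (intro sum.cong refl) (simp add: ext LB(1)[symmetric])
    also have "\<dots> = (if a = y then \<phi> (merge L B (x, z)) else 0)"
      using fin that x by (simp add: sum.delta L_def)
    finally show ?thesis .
  qed
  have "braket {..<N} \<phi> (op_app {..<N} (extend_op l N (matrix_unit y x)) \<phi>) =
      (\<Sum>a\<in>configs L. \<Sum>z\<in>configs B.
        if a = y then cnj (\<phi> (merge L B (y, z))) * \<phi> (merge L B (x, z)) else 0)"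
    unfolding braket_def LB(1) sum_configs_merge[OF LB(3)]
    by (intro sum.cong refl) (simp add: app LB(1)[symmetric])
  also have "\<dots> = (\<Sum>z\<in>configs B. cnj (\<phi> (merge L B (y, z))) * \<phi> (merge L B (x, z)))"
    using fin y by (subst sum.swap) (simp add: sum.delta L_def)
  finally show ?thesis
    using x y unfolding qstate_def reduced_density_def partial_trace_def ketbra_def L_def[symmetric] LB(2)
    by (simp add: mult.commute)
qed


subsection \<open>Integrals over projective space\<close>

lemma rep_cproj_nonzero: "rep_cproj p \<noteq> 0"
  using Quotient3_rep_reflp[OF Quotient3_cproj, of p] by simp

lemma abs_rep_cproj: "abs_cproj (rep_cproj p) = p"
  using Quotient3_abs_rep[OF Quotient3_cproj] .

lemma zero_ent_state_abs:
  assumes "v \<noteq> 0"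
  shows "zero_ent_state (abs_cproj v) l T =
    braket {..<l} (tensor_power l v) (op_app {..<l} T (tensor_power l v)) / herm v v ^ l"
  using assms by (subst zero_ent_state.abs_eq) (auto intro: exI[of _ 1])

lemma zero_ent_state_matrix_unit:
  assumes "x \<in> configs {..<l}" "y \<in> configs {..<l}" and "v \<noteq> 0"
  shows "zero_ent_state (abs_cproj v) l (matrix_unit y x) =
    tensor_power l v x * cnj (tensor_power l v y) / herm v v ^ l"
  using assms by (simp add: zero_ent_state_abs braket_matrix_unit finite_configs)

text \<open>The universal property of the quotient topology: only the pullback to nonzero vectors
  has to be continuous, and \<open>g\<close> is arbitrary at 0.\<close>

lemma continuous_on_cprojI:
  fixes f :: "'d::finite cproj \<Rightarrow> 'b::topological_space"
  assumes "\<And>v. v \<noteq> 0 \<Longrightarrow> f (abs_cproj v) = g v" and g: "continuous_on (- {0}) g"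
  shows "continuous_on UNIV f"
proof -
  have "open (f -` U)" if "open U" for U
  proof -
    have "{v. v \<noteq> 0 \<and> abs_cproj v \<in> f -` U} = g -` U \<inter> - {0}"
      using assms(1) by auto
    then show ?thesis
      using that g continuous_on_open_vimage[of "- {0}" g] by (simp add: open_cproj_def open_Compl)
  qed
  then show ?thesis
    by (simp add: continuous_on_open_vimage)
qed

lemma herm_self: "herm v v = complex_of_real ((norm v)\<^sup>2)"
proof -
  have "(norm v)\<^sup>2 = (\<Sum>i\<in>UNIV. (cmod (v $ i))\<^sup>2)"
    by (simp add: norm_vec_def L2_set_def sum_nonneg)
  then show ?thesis
    unfolding herm_def by (simp only: of_real_sum complex_norm_square mult.commute)
qed

text \<open>
  Nothing is known about the measurability of \<^const>\<open>rep_cproj\<close>, so integrands are handled through the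
  scale-invariant function \<^const>\<open>zero_ent_state\<close>.
\<close>

lemma integrable_zero_ent_state_matrix_unit:
  fixes \<mu> :: "'d::finite cproj measure"
  assumes "prob_space \<mu>" and "sets \<mu> = sets borel"
    and x: "x \<in> configs {..<l}" and y: "y \<in> configs {..<l}"
  shows "integrable \<mu> (\<lambda>p. zero_ent_state p l (matrix_unit y x))"
proof -
  interpret prob_space \<mu> by fact
  let ?g = "\<lambda>v. tensor_power l v x * cnj (tensor_power l v y) / herm v v ^ l"
  show ?thesis
  proof (rule integrable_const_bound[where B = 1])
    have "continuous_on (- {0}) ?g"
      using x y unfolding tensor_power_def
      by (simp add: herm_self) (intro continuous_intros; simp)
    then have "continuous_on UNIV (\<lambda>p. zero_ent_state p l (matrix_unit y x))"
      using x y by (intro continuous_on_cprojI[where g = ?g]) (auto simp: zero_ent_state_matrix_unit)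
    then have "(\<lambda>p. zero_ent_state p l (matrix_unit y x)) \<in> borel_measurable borel"
      by (rule borel_measurable_continuous_onI)
    then show "(\<lambda>p. zero_ent_state p l (matrix_unit y x)) \<in> borel_measurable \<mu>"
      by (simp add: measurable_cong_sets[OF assms(2) refl])
    \<comment> \<open>Each coordinate is at most the norm in modulus, so the \<open>2 * l\<close>
      coordinates in the numerator are dominated by the denominator
      \<open>norm v ^ (2 * l)\<close>.\<close>
    have "cmod (zero_ent_state p l (matrix_unit y x)) \<le> 1" for p
    proof -
      define v where "v = rep_cproj p"
      have v: "v \<noteq> 0" "p = abs_cproj v"
        by (simp_all add: v_def rep_cproj_nonzero abs_rep_cproj)
      have le: "cmod (tensor_power l v a) \<le> norm v ^ l" for a
      proof -
        have "(\<Prod>i<l. cmod (v $ a i)) \<le> (\<Prod>i<l. norm v)"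
          by (intro prod_mono) (auto intro: Finite_Cartesian_Product.norm_nth_le)
        then show ?thesis
          by (simp add: tensor_power_def prod_norm[symmetric])
      qed
      have "cmod (tensor_power l v x * cnj (tensor_power l v y)) \<le> norm v ^ l * norm v ^ l"
        unfolding norm_mult complex_mod_cnj by (intro mult_mono le) auto
      then show ?thesis
        using v x y by (simp add: zero_ent_state_matrix_unit norm_divide norm_power herm_self
            power2_eq_square power_mult_distrib norm_mult)
    qed
    then show "AE p in \<mu>. cmod (zero_ent_state p l (matrix_unit y x)) \<le> 1"
      by simp
  qed
qed

lemma sum_tensor_power:
  fixes v w :: "complex ^ 'd::finite"
  shows "(\<Sum>x\<in>configs {..<l}. cnj (tensor_power l v x) * tensor_power l w x) = herm v w ^ l"
proof -
  have "(\<Sum>x\<in>configs {..<l}. cnj (tensor_power l v x) * tensor_power l w x) =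
      (\<Sum>x\<in>configs {..<l}. \<Prod>i<l. cnj (v $ x i) * w $ x i)"
    by (intro sum.cong refl) (simp add: tensor_power_def prod.distrib)
  also have "\<dots> = (\<Prod>i<l. herm v w)"
    unfolding configs_def herm_def by (subst prod_sum_PiE) auto
  finally show ?thesis
    by simp
qed

text \<open>Each factor is an entry of a rank-one operator, so the sum over paths decouples: summing
  over the configuration at one vertex yields the \<open>l\<close>-th power of the overlap of two
  cyclically adjacent vectors.\<close>

lemma sum_paths_zero_ent_state:
  fixes p :: "nat \<Rightarrow> 'd::finite cproj"
  shows "(\<Sum>w\<in>{..<n} \<rightarrow>\<^sub>E configs {..<l}. \<Prod>\<alpha><n.
      zero_ent_state (p \<alpha>) l (matrix_unit (w (Suc \<alpha> mod n)) (w \<alpha>))) = cyclic_overlap n p ^ l"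
proof -
  let ?S = "configs {..<l} :: 'd config set"
  define v where "v \<alpha> = rep_cproj (p \<alpha>)" for \<alpha>
  define t where "t \<alpha> = tensor_power l (v \<alpha>)" for \<alpha>
  define h where "h = (\<Prod>\<alpha><n. herm (v \<alpha>) (v \<alpha>) ^ l)"
  \<comment> \<open>The cyclic predecessor moves the two factors that contain \<open>w \<alpha>\<close> to the same index, so that the
    sum over \<open>w\<close> becomes a product of sums.\<close>
  define pre where "pre \<alpha> = (\<alpha> + n - 1) mod n" for \<alpha>
  have pre: "pre (Suc \<alpha> mod n) = \<alpha>" if "\<alpha> < n" for \<alpha>
    using that by (cases "Suc \<alpha> = n") (auto simp: pre_def)
  have v: "v \<alpha> \<noteq> 0" "p \<alpha> = abs_cproj (v \<alpha>)" for \<alpha>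
    by (simp_all add: v_def rep_cproj_nonzero abs_rep_cproj)
  have "(\<Prod>\<alpha><n. zero_ent_state (p \<alpha>) l (matrix_unit (w (Suc \<alpha> mod n)) (w \<alpha>))) =
      (\<Prod>\<alpha><n. cnj (t (pre \<alpha>) (w \<alpha>)) * t \<alpha> (w \<alpha>)) / h"
    if w: "w \<in> {..<n} \<rightarrow>\<^sub>E ?S" for w
  proof -
    have wS: "w \<alpha> \<in> ?S" "w (Suc \<alpha> mod n) \<in> ?S" if "\<alpha> < n" for \<alpha>
      using w that PiE_mem[OF w, of "Suc \<alpha> mod n"] by auto
    have "(\<Prod>\<alpha><n. zero_ent_state (p \<alpha>) l (matrix_unit (w (Suc \<alpha> mod n)) (w \<alpha>))) =
        (\<Prod>\<alpha><n. t \<alpha> (w \<alpha>) * cnj (t \<alpha> (w (Suc \<alpha> mod n))) / herm (v \<alpha>) (v \<alpha>) ^ l)"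
      using wS v(1) by (intro prod.cong refl) (simp add: v(2) zero_ent_state_matrix_unit t_def)
    also have "\<dots> = (\<Prod>\<alpha><n. t \<alpha> (w \<alpha>)) * (\<Prod>\<alpha><n. cnj (t \<alpha> (w (Suc \<alpha> mod n)))) / h"
      by (simp add: h_def prod_dividef prod.distrib)
    also have "(\<Prod>\<alpha><n. cnj (t \<alpha> (w (Suc \<alpha> mod n)))) =
        (\<Prod>\<alpha><n. cnj (t (pre (Suc \<alpha> mod n)) (w (Suc \<alpha> mod n))))"
      by (intro prod.cong) (auto simp: pre)
    also have "\<dots> = (\<Prod>\<alpha><n. cnj (t (pre \<alpha>) (w \<alpha>)))"
      by (rule prod_cyclic_shift)
    finally show ?thesis
      by (simp add: prod.distrib mult.commute)
  qed
  then have "(\<Sum>w\<in>{..<n} \<rightarrow>\<^sub>E ?S. \<Prod>\<alpha><n.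
      zero_ent_state (p \<alpha>) l (matrix_unit (w (Suc \<alpha> mod n)) (w \<alpha>))) =
      (\<Sum>w\<in>{..<n} \<rightarrow>\<^sub>E ?S. \<Prod>\<alpha><n. cnj (t (pre \<alpha>) (w \<alpha>)) * t \<alpha> (w \<alpha>)) / h"
    unfolding sum_divide_distrib by (intro sum.cong refl)
  also have "\<dots> = (\<Prod>\<alpha><n. \<Sum>x\<in>?S. cnj (t (pre \<alpha>) x) * t \<alpha> x) / h"
    by (subst prod_sum_PiE) (auto simp: finite_configs)
  also have "\<dots> = (\<Prod>\<alpha><n. herm (v (pre \<alpha>)) (v \<alpha>) ^ l) / h"
    by (simp add: t_def sum_tensor_power)
  also have "(\<Prod>\<alpha><n. herm (v (pre \<alpha>)) (v \<alpha>) ^ l) =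
      (\<Prod>\<alpha><n. herm (v (pre (Suc \<alpha> mod n))) (v (Suc \<alpha> mod n)) ^ l)"
    by (rule prod_cyclic_shift[symmetric])
  also have "\<dots> = (\<Prod>\<alpha><n. herm (v \<alpha>) (v (Suc \<alpha> mod n)) ^ l)"
    by (intro prod.cong) (auto simp: pre)
  finally show ?thesis
    by (simp add: cyclic_overlap_def h_def v_def prod_dividef power_divide prod_power_distrib)
qed

text \<open>Writing the integrand as the path sum turns it into a finite sum of products of
  one-point functions. These are integrable by scale invariance, which avoids the chosen
  representatives in \<open>cyclic_overlap\<close>, and the product measure factorises their
  integrals.\<close>

lemma integral_cyclic_overlap:
  fixes \<mu> :: "'d::finite cproj measure"
  assumes "prob_space \<mu>" and "sets \<mu> = sets borel"
  shows "(\<integral>p. cyclic_overlap n p ^ l \<partial>(\<Pi>\<^sub>M \<alpha>\<in>{..<n}. \<mu>)) =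
    (\<Sum>w\<in>{..<n} \<rightarrow>\<^sub>E configs {..<l}. \<Prod>\<alpha><n.
      \<integral>p. zero_ent_state p l (matrix_unit (w (Suc \<alpha> mod n)) (w \<alpha>)) \<partial>\<mu>)"
proof -
  interpret prob_space \<mu> by fact
  interpret product_prob_space "\<lambda>\<alpha>::nat. \<mu>" "{..<n}" ..
  have int: "integrable \<mu> (\<lambda>p. zero_ent_state p l (matrix_unit (w (Suc \<alpha> mod n)) (w \<alpha>)))"
    if "w \<in> {..<n} \<rightarrow>\<^sub>E configs {..<l}" "\<alpha> < n" for w \<alpha>
  proof (rule integrable_zero_ent_state_matrix_unit[OF assms])
    show "w \<alpha> \<in> configs {..<l}" "w (Suc \<alpha> mod n) \<in> configs {..<l}"
      using that PiE_mem[OF that(1), of "Suc \<alpha> mod n"] by auto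
  qed
  let ?K = "\<lambda>w \<alpha> p. zero_ent_state p l (matrix_unit (w (Suc \<alpha> mod n)) (w \<alpha>)) :: complex"
  have "(\<integral>p. (\<Prod>\<alpha><n. ?K w \<alpha> (p \<alpha>)) \<partial>(\<Pi>\<^sub>M \<alpha>\<in>{..<n}. \<mu>)) = (\<Prod>\<alpha><n. \<integral>p. ?K w \<alpha> p \<partial>\<mu>)"
    and "integrable (\<Pi>\<^sub>M \<alpha>\<in>{..<n}. \<mu>) (\<lambda>p. \<Prod>\<alpha><n. ?K w \<alpha> (p \<alpha>))"
    if "w \<in> {..<n} \<rightarrow>\<^sub>E configs {..<l}" for w
    using int[OF that] product_integral_prod[of "{..<n}" "?K w"] product_integrable_prod[of "{..<n}" "?K w"]
    by simp_all
  then show ?thesis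
    unfolding sum_paths_zero_ent_state[symmetric] by (subst Bochner_Integration.integral_sum) simp_all
qed

section \<open>Convergence of the traces and of their logarithms\<close>

text \<open>The conjuncts \<open>Z \<in> \<real>\<close> and \<open>Re Z > 0\<close> ensure that
  \<open>ln (Re Z)\<close> is the genuine logarithm of the complex integral
  \<open>Z\<close>.\<close>

theorem theorem2:
  fixes D n m :: nat
    and \<Psi> :: "nat \<Rightarrow> 'd::finite vect"
    and \<psi> :: "nat \<Rightarrow> 'd oper \<Rightarrow> complex"
    and \<mu> :: "'d cproj measure"
    and A :: "nat \<Rightarrow> nat set"
  assumes "D \<ge> 1" and "CARD('d) = D + 1"
    and "\<And>N. N \<ge> 1 \<Longrightarrow> \<Psi> N \<in> sym_hilb N \<and> \<Psi> N \<noteq> (\<lambda>x. 0)"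
    and "local_op_limit \<Psi> \<psi>"
    and "prob_space \<mu>" and "sets \<mu> = sets borel"
    and "\<And>l T. T \<in> End_hilb {..<l} \<Longrightarrow> \<psi> l T = (\<integral>p. zero_ent_state p l T \<partial>\<mu>)"
    and "n > 1" and "m \<ge> 1"
    and "\<And>N. N \<ge> m \<Longrightarrow> A N \<subseteq> {..<N} \<and> card (A N) = m"
  shows "let Z = (\<integral>p. cyclic_overlap n p ^ m \<partial>(\<Pi>\<^sub>M \<alpha>\<in>{..<n}. \<mu>))
    in Z \<in> \<real> \<and> Re Z > 0 \<and>
       (\<lambda>N. renyi_entropy n N (\<Psi> N) (A N)) \<longlonglongrightarrow> 1 / (1 - real n) * ln (Re Z)"
proof -
  \<comment> \<open>Limits are computed on the first \<open>m\<close> sites, where local operators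
    act; symmetry transfers the result to \<open>A N\<close> at the end.\<close>
  define M where "M = {..<m}"
  define Z where "Z = (\<integral>p. cyclic_overlap n p ^ m \<partial>(\<Pi>\<^sub>M \<alpha>\<in>{..<n}. \<mu>))"
  define t where "t N = op_trace M (op_pow M (reduced_density N M (\<Psi> N)) n)" for N
  have fin: "finite (configs M :: 'd config set)"
    by (simp add: M_def finite_configs)
  have entry: "(\<lambda>N. reduced_density N M (\<Psi> N) x y) \<longlonglongrightarrow> (\<integral>p. zero_ent_state p m (matrix_unit y x) \<partial>\<mu>)"
    if "x \<in> configs M" "y \<in> configs M" for x y
  proof -
    have E: "matrix_unit y x \<in> End_hilb {..<m}"
      using that by (simp add: M_def matrix_unit_End_hilb)
    have "(\<lambda>N. qstate N (\<Psi> N) (extend_op m N (matrix_unit y x))) \<longlonglongrightarrow>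
        (\<integral>p. zero_ent_state p m (matrix_unit y x) \<partial>\<mu>)"
      using assms(4)[unfolded local_op_limit_def, rule_format, OF E] unfolding assms(7)[OF E] .
    moreover have "\<forall>\<^sub>F N in sequentially. qstate N (\<Psi> N) (extend_op m N (matrix_unit y x)) =
        reduced_density N M (\<Psi> N) x y"
      using eventually_ge_at_top[of m]
    proof eventually_elim
      case (elim N)
      with that show ?case
        unfolding M_def by (intro qstate_extend_matrix_unit)
    qed
    ultimately show ?thesis
      by (rule Lim_transform_eventually)
  qed
  \<comment> \<open>The trace is a fixed polynomial in finitely many entries, so entrywise
    convergence suffices.\<close>
  have lim: "t \<longlonglongrightarrow> Z"
  proof -
    have t: "t N = (\<Sum>w\<in>{..<n} \<rightarrow>\<^sub>E configs M. \<Prod>\<alpha><n.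
        reduced_density N M (\<Psi> N) (w \<alpha>) (w (Suc \<alpha> mod n)))" for N
      unfolding t_def using fin assms(8) by (intro op_trace_pow_eq) auto
    show ?thesis
      unfolding t Z_def integral_cyclic_overlap[OF assms(5,6)] M_def[symmetric]
    proof (intro tendsto_sum tendsto_prod entry)
      fix w \<alpha> assume "w \<in> {..<n} \<rightarrow>\<^sub>E (configs M :: 'd config set)" and "\<alpha> \<in> {..<n}"
      then show "w \<alpha> \<in> configs M" "w (Suc \<alpha> mod n) \<in> configs M"
        using PiE_mem[of w "{..<n}" _ "Suc \<alpha> mod n"] by auto
    qed
  qed
  \<comment> \<open>Every \<open>t N\<close> is real, and the reals are closed in the complex
    plane.\<close>
  have real: "Z \<in> \<real>"
    using closed_sequentially[OF closed_complex_Reals _ lim] renyi_trace_real by (auto simp: t_def)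
  obtain c where "c > 0" and c: "\<And>N (\<phi> :: 'd vect). M \<subseteq> {..<N} \<Longrightarrow> \<phi> \<in> hilb {..<N} \<Longrightarrow>
      \<phi> \<noteq> (\<lambda>x. 0) \<Longrightarrow> c \<le> Re (op_trace M (op_pow M (reduced_density N M \<phi>) n))"
    using reduced_density_trace_pow_ge[of M n, where 'd = 'd] assms(8) by (auto simp: M_def)
  \<comment> \<open>Since \<open>c\<close> does not depend on \<open>N\<close>, the bound survives
    the limit and keeps it away from 0, where \<open>ln\<close> is discontinuous. From
    \<open>N \<ge> m \<ge> 1\<close> follows that \<open>\<Psi> N\<close> is nonzero.\<close>
  have "\<forall>\<^sub>F N in sequentially. c \<le> Re (t N)"
    using eventually_ge_at_top[of m]
  proof eventually_elim
    case (elim N)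
    with assms(3)[of N] assms(9) show ?case
      unfolding t_def by (intro c) (auto simp: M_def sym_hilb_def)
  qed
  then have "c \<le> Re Z"
    by (intro tendsto_lowerbound[OF tendsto_Re[OF lim]]) auto
  with \<open>c > 0\<close> have pos: "Re Z > 0"
    by simp
  have "(\<lambda>N. 1 / (1 - real n) * ln (Re (t N))) \<longlonglongrightarrow> 1 / (1 - real n) * ln (Re Z)"
    using pos by (intro tendsto_intros lim) auto
  moreover have "\<forall>\<^sub>F N in sequentially.
      1 / (1 - real n) * ln (Re (t N)) = renyi_entropy n N (\<Psi> N) (A N)"
    using eventually_ge_at_top[of m]
  proof eventually_elim
    case (elim N)
    have sym: "\<Psi> N \<in> sym_hilb N"
      using elim assms(3)[of N] assms(9) by simp
    have sub: "A N \<subseteq> {..<N}" "M \<subseteq> {..<N}" "card (A N) = card M"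
      using elim assms(10)[of N] by (auto simp: M_def)
    obtain e where "bij_betw e (configs M) (configs (A N))"
      and "\<And>x y. x \<in> configs M \<Longrightarrow> y \<in> configs M \<Longrightarrow>
        reduced_density N (A N) (\<Psi> N) (e x) (e y) = reduced_density N M (\<Psi> N) x y"
      using reduced_density_permute[OF sym sub] by blast
    then have "op_trace (A N) (op_pow (A N) (reduced_density N (A N) (\<Psi> N)) n) = t N"
      unfolding t_def by (rule op_trace_pow_reindex)
    then show ?case
      by (simp add: renyi_entropy_def)
  qed
  ultimately have "(\<lambda>N. renyi_entropy n N (\<Psi> N) (A N)) \<longlonglongrightarrow> 1 / (1 - real n) * ln (Re Z)"
    by (rule Lim_transform_eventually)
  with real pos show ?thesis
    by (simp add: Z_def)
qed

end
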